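(* Let $G$ be a topological group. Then the topological group $G\times G$ is $\mathbb R$-factorizable if and only if the product $G\times G$ is multiplicatively $\mathbb R$-factorizable.
   Context: All topological spaces and topological groups are assumed to be Tychonoff (including Hausdorff). A topological group $G$ is $\mathbb R$-factorizable if for any continuous function $f\colon G\to\mathbb R$ there exist a second-countable topological group $H$, a continuous homomorphism $h\colon G\to H$, and a continuous function $g\colon H\to\mathbb R$ such that $f=g\circ h$. A product $X\times Y$ of topological spaces is (multiplicatively) $\mathbb R$-factorizable if for any continuous function $f\colon X\times Y\to\mathbb R$ there exist second-countable spaces $X',Y'$ and continuous maps $g_1\colon X\to X'$, $g_2\colon Y\to Y'$, and $h\colon X'\times Y'\to\mathbb R$ such that $f=h\circ(g_1\times g_2)$. *)

theory Defs
  imports "HOL-Analysis.Analysis" "HOL-Algebra.Group"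
begin

definition tychonoff_space :: "'a topology \<Rightarrow> bool" where
  "tychonoff_space X \<longleftrightarrow> completely_regular_space X \<and> Hausdorff_space X"

locale topological_group = group G for G (structure) +
  fixes T :: "'a topology"
  assumes topspace_eq_carrier: "topspace T = carrier G"
    and tychonoff: "tychonoff_space T"
    and continuous_mult: "continuous_map (prod_topology T T) T (\<lambda>(x, y). x \<otimes> y)"
    and continuous_inv: "continuous_map T T (\<lambda>x. inv x)"

text \<open>
  HOL cannot quantify existentially over types, so the second-countable groups and spaces through
  which a function is factored are taken with underlying type \<^typ>\<open>real\<close>. Nothing is lost:
  a second-countable Hausdorff space has at most continuum many points, so any factorization
  through spaces or groups over other types can be transported to \<^typ>\<open>real\<close>; see the lemmas
  \<open>group_factorization_over_real\<close> and \<open>product_factorization_over_real\<close> below.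
\<close>

definition R_factorizable_group :: "('a, 'm) monoid_scheme \<Rightarrow> 'a topology \<Rightarrow> bool" where
  "R_factorizable_group G T \<longleftrightarrow>
    (\<forall>f. continuous_map T euclideanreal f \<longrightarrow>
      (\<exists>(H :: real monoid) S h g.
        topological_group H S \<and> second_countable S \<and>
        h \<in> hom G H \<and> continuous_map T S h \<and>
        continuous_map S euclideanreal g \<and>
        (\<forall>x \<in> topspace T. f x = g (h x))))"

definition multiplicatively_R_factorizable :: "'a topology \<Rightarrow> 'b topology \<Rightarrow> bool" where
  "multiplicatively_R_factorizable X Y \<longleftrightarrow>
    (\<forall>f. continuous_map (prod_topology X Y) euclideanreal f \<longrightarrow>
      (\<exists>(X' :: real topology) (Y' :: real topology) g1 g2 h.
        tychonoff_space X' \<and> second_countable X' \<and>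
        tychonoff_space Y' \<and> second_countable Y' \<and>
        continuous_map X X' g1 \<and> continuous_map Y Y' g2 \<and>
        continuous_map (prod_topology X' Y') euclideanreal h \<and>
        (\<forall>x \<in> topspace X. \<forall>y \<in> topspace Y. f (x, y) = h (g1 x, g2 y))))"

lemma second_countable_Hausdorff_lepoll_real:
  assumes "second_countable X" "Hausdorff_space X"
  shows "topspace X \<lesssim> (UNIV :: real set)"
proof -
  obtain \<B> where B: "countable \<B>" "\<And>V. V \<in> \<B> \<Longrightarrow> openin X V"
    "\<And>U x. openin X U \<Longrightarrow> x \<in> U \<Longrightarrow> \<exists>V \<in> \<B>. x \<in> V \<and> V \<subseteq> U"
    using assms(1) unfolding second_countable_def by metis
  define c where "c x = to_nat_on \<B> ` {V \<in> \<B>. x \<in> V}" for x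
  have "inj_on c (topspace X)"
  proof (rule inj_onI, rule ccontr)
    fix x y assume xy: "x \<in> topspace X" "y \<in> topspace X" "c x = c y" "x \<noteq> y"
    then obtain U where U: "openin X U" "x \<in> U" "y \<notin> U"
      using assms(2) unfolding Hausdorff_space_def disjnt_iff by metis
    then obtain V where V: "V \<in> \<B>" "x \<in> V" "V \<subseteq> U"
      using B(3) by metis
    then have "to_nat_on \<B> V \<in> c y"
      using xy(3) unfolding c_def by blast
    then obtain W where "W \<in> \<B>" "y \<in> W" "to_nat_on \<B> V = to_nat_on \<B> W"
      unfolding c_def by blast
    then show False
      using V U to_nat_on_inj[OF B(1)] by auto
  qed
  then have "topspace X \<lesssim> (UNIV :: nat set set)"
    unfolding lepoll_def by blast
  then show ?thesis
    using nat_sets_eqpoll_reals lepoll_trans eqpoll_imp_lepoll by blast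
qed

lemma second_countable_tychonoff_real_copy:
  assumes "second_countable X" "tychonoff_space X"
  obtains X' :: "real topology" and e d where
    "homeomorphic_maps X X' e d" "second_countable X'" "tychonoff_space X'"
proof -
  obtain e :: "'a \<Rightarrow> real" where e: "inj_on e (topspace X)"
    using second_countable_Hausdorff_lepoll_real assms
    unfolding lepoll_def tychonoff_space_def by blast
  define d where "d = inv_into (topspace X) e"
  define X' where "X' = pullback_topology (e ` topspace X) d X"
  have de: "d (e x) = x" if "x \<in> topspace X" for x
    using e that by (simp add: d_def)
  have top: "topspace X' = e ` topspace X"
    unfolding X'_def topspace_pullback_topology using de by auto
  have "continuous_map X X' e"
    unfolding X'_def
  proof (rule continuous_map_pullback')
    show "continuous_map X X (d \<circ> e)"
      by (rule continuous_map_eq[OF continuous_map_id]) (simp add: de)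
  qed auto
  moreover have "continuous_map X' X d"
    using continuous_map_pullback[OF continuous_map_id, of "e ` topspace X" d X]
    by (simp add: X'_def id_def comp_def)
  ultimately have hm: "homeomorphic_maps X X' e d"
    unfolding homeomorphic_maps_def top using de by auto
  then have "X homeomorphic_space X'"
    unfolding homeomorphic_space_def by blast
  then have "second_countable X'" "tychonoff_space X'"
    using assms homeomorphic_space_second_countability homeomorphic_completely_regular_space
      homeomorphic_Hausdorff_space unfolding tychonoff_space_def by blast+
  with hm that show thesis by blast
qed

lemma product_factorization_over_real:
  assumes X': "tychonoff_space X'" "second_countable X'"
    and Y': "tychonoff_space Y'" "second_countable Y'"
    and g: "continuous_map X X' g1" "continuous_map Y Y' g2"
    and h: "continuous_map (prod_topology X' Y') euclideanreal h"
    and f: "\<forall>x \<in> topspace X. \<forall>y \<in> topspace Y. f (x, y) = h (g1 x, g2 y)"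
  shows "\<exists>(X'' :: real topology) (Y'' :: real topology) g1 g2 h.
    tychonoff_space X'' \<and> second_countable X'' \<and>
    tychonoff_space Y'' \<and> second_countable Y'' \<and>
    continuous_map X X'' g1 \<and> continuous_map Y Y'' g2 \<and>
    continuous_map (prod_topology X'' Y'') euclideanreal h \<and>
    (\<forall>x \<in> topspace X. \<forall>y \<in> topspace Y. f (x, y) = h (g1 x, g2 y))"
proof -
  obtain X'' :: "real topology" and e d where
    X'': "homeomorphic_maps X' X'' e d" "second_countable X''" "tychonoff_space X''"
    using second_countable_tychonoff_real_copy X' by metis
  obtain Y'' :: "real topology" and e' d' where
    Y'': "homeomorphic_maps Y' Y'' e' d'" "second_countable Y''" "tychonoff_space Y''"
    using second_countable_tychonoff_real_copy Y' by metis
  have "continuous_map X X'' (e \<circ> g1)" "continuous_map Y Y'' (e' \<circ> g2)"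
    using g X'' Y'' continuous_map_compose unfolding homeomorphic_maps_def by blast+
  moreover have "continuous_map (prod_topology X'' Y'') euclideanreal (h \<circ> (\<lambda>(x, y). (d x, d' y)))"
    using X''(1) Y''(1) h
    by (intro continuous_map_compose[OF _ h]) (auto simp: continuous_map_prod_top homeomorphic_maps_def)
  moreover have "f (x, y) = (h \<circ> (\<lambda>(x, y). (d x, d' y))) ((e \<circ> g1) x, (e' \<circ> g2) y)"
    if "x \<in> topspace X" "y \<in> topspace Y" for x y
  proof -
    have "g1 x \<in> topspace X'" "g2 y \<in> topspace Y'"
      using g that continuous_map_image_subset_topspace by blast+
    then show ?thesis
      using X''(1) Y''(1) f that by (simp add: homeomorphic_maps_def)
  qed
  ultimately show ?thesis
    using X'' Y'' by blast
qed

lemma group_factorization_over_real: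
  assumes H: "topological_group H S" and S: "second_countable S"
    and h: "h \<in> hom G H" "continuous_map T S h"
    and g: "continuous_map S euclideanreal g"
    and f: "\<forall>x \<in> topspace T. f x = g (h x)"
  shows "\<exists>(H' :: real monoid) S' h g.
    topological_group H' S' \<and> second_countable S' \<and>
    h \<in> hom G H' \<and> continuous_map T S' h \<and>
    continuous_map S' euclideanreal g \<and>
    (\<forall>x \<in> topspace T. f x = g (h x))"
proof -
  interpret H: topological_group H S by (rule H)
  obtain S' :: "real topology" and e d where
    S': "homeomorphic_maps S S' e d" "second_countable S'" "tychonoff_space S'"
    using second_countable_tychonoff_real_copy S H.tychonoff by metis
  have ce: "continuous_map S S' e" and cd: "continuous_map S' S d"
    and de: "\<And>x. x \<in> carrier H \<Longrightarrow> d (e x) = x" and ed: "\<And>y. y \<in> topspace S' \<Longrightarrow> e (d y) = y"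
    using S'(1) by (auto simp: homeomorphic_maps_def H.topspace_eq_carrier)
  have e_in: "\<And>x. x \<in> carrier H \<Longrightarrow> e x \<in> topspace S'"
    and d_in: "\<And>y. y \<in> topspace S' \<Longrightarrow> d y \<in> carrier H"
    using continuous_map_image_subset_topspace[OF ce] continuous_map_image_subset_topspace[OF cd]
    by (auto simp: H.topspace_eq_carrier)
  define H' :: "real monoid" where
    "H' = \<lparr>carrier = topspace S', mult = (\<lambda>x y. e (d x \<otimes>\<^bsub>H\<^esub> d y)), one = e \<one>\<^bsub>H\<^esub>\<rparr>"
  have grp: "group H'"
  proof (rule groupI)
    fix x assume "x \<in> carrier H'"
    then show "\<exists>y \<in> carrier H'. y \<otimes>\<^bsub>H'\<^esub> x = \<one>\<^bsub>H'\<^esub>"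
      by (intro bexI[of _ "e (inv\<^bsub>H\<^esub> d x)"]) (simp_all add: H'_def de e_in d_in)
  qed (simp_all add: H'_def de ed e_in d_in H.m_assoc)
  have inv_eq: "inv\<^bsub>H'\<^esub> x = e (inv\<^bsub>H\<^esub> d x)" if "x \<in> topspace S'" for x
    using that by (intro group.inv_equality[OF grp]) (simp_all add: H'_def de e_in d_in)
  have "continuous_map (prod_topology S' S') S' (e \<circ> (\<lambda>(x, y). x \<otimes>\<^bsub>H\<^esub> y) \<circ> (\<lambda>(x, y). (d x, d y)))"
    using cd by (intro continuous_map_compose[OF _ continuous_map_compose[OF H.continuous_mult ce]])
      (auto simp: continuous_map_prod_top)
  then have "continuous_map (prod_topology S' S') S' (\<lambda>(x, y). x \<otimes>\<^bsub>H'\<^esub> y)"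
    by (rule continuous_map_eq) (auto simp: H'_def)
  moreover have "continuous_map S' S' (e \<circ> (\<lambda>x. inv\<^bsub>H\<^esub> x) \<circ> d)"
    by (intro continuous_map_compose[OF cd continuous_map_compose[OF H.continuous_inv ce]])
  then have "continuous_map S' S' (\<lambda>x. inv\<^bsub>H'\<^esub> x)"
    by (rule continuous_map_eq) (auto simp: inv_eq)
  ultimately have "topological_group H' S'"
    using grp S'(3)
    by (auto simp: topological_group_def topological_group_axioms_def H'_def)
  moreover have "e \<circ> h \<in> hom G H'"
    using h(1) by (auto simp: hom_def H'_def Pi_iff de e_in)
  moreover have "continuous_map T S' (e \<circ> h)"
    using h(2) ce by (rule continuous_map_compose)
  moreover have "continuous_map S' euclideanreal (g \<circ> d)"
    using cd g by (rule continuous_map_compose)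
  moreover have "f x = (g \<circ> d) ((e \<circ> h) x)" if "x \<in> topspace T" for x
    using f that de continuous_map_image_subset_topspace[OF h(2)]
    by (auto simp: H.topspace_eq_carrier)
  ultimately show ?thesis
    using S'(2) by blast
qed

end

theory Submission
  imports Defs
begin

text \<open>
  If \<open>f\<close> factors through a homomorphism \<open>h\<close> on \<open>G \<times> G\<close>, then \<open>h (x, y) = h (x, 1) h (1, y)\<close> turns this into
  a multiplicative factorization. Conversely, multiplicative factorizability applied to \<open>\<phi> (x y)\<close>, for a
  continuous real function \<open>\<phi>\<close> on \<open>G\<close>, yields countably many continuous functions on \<open>G\<close> whose initial
  topology already makes \<open>\<phi> (x y)\<close> jointly continuous. Closing up the countable family obtained from \<open>f\<close>
  under this operation and under \<open>\<phi> (x) \<mapsto> \<phi> (x\<^sup>-\<^sup>1)\<close> gives a coarser second-countable group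
  topology on \<open>G\<close>, possibly not Hausdorff, for which \<open>f\<close> is still continuous. The image of \<open>G\<close> under the
  tuple of all members of the family is its Hausdorff quotient \<open>H\<close>, and \<open>f\<close> factors through \<open>H \<times> H\<close>.
\<close>

section \<open>Second-countable spaces\<close>

lemma second_countable_prod_topology:
  assumes "second_countable X" "second_countable Y"
  shows "second_countable (prod_topology X Y)"
proof -
  obtain \<B> where B: "countable \<B>" "\<And>V. V \<in> \<B> \<Longrightarrow> openin X V"
    "\<And>U x. openin X U \<Longrightarrow> x \<in> U \<Longrightarrow> \<exists>V \<in> \<B>. x \<in> V \<and> V \<subseteq> U"
    using assms(1) unfolding second_countable_def by metis
  obtain \<C> where C: "countable \<C>" "\<And>V. V \<in> \<C> \<Longrightarrow> openin Y V"
    "\<And>U x. openin Y U \<Longrightarrow> x \<in> U \<Longrightarrow> \<exists>V \<in> \<C>. x \<in> V \<and> V \<subseteq> U"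
    using assms(2) unfolding second_countable_def by metis
  let ?D = "(\<lambda>(U, V). U \<times> V) ` (\<B> \<times> \<C>)"
  show ?thesis
    unfolding second_countable_def
  proof (intro exI conjI ballI allI impI)
    show "countable ?D"
      using B(1) C(1) by simp
    show "openin (prod_topology X Y) V" if "V \<in> ?D" for V
      using that B(2) C(2) by (auto simp: openin_prod_Times_iff)
    fix W z assume W: "openin (prod_topology X Y) W \<and> z \<in> W"
    obtain x y where z: "z = (x, y)" by fastforce
    then obtain U V where UV: "openin X U" "openin Y V" "x \<in> U" "y \<in> V" "U \<times> V \<subseteq> W"
      using W unfolding openin_prod_topology_alt by meson
    obtain B' C' where "B' \<in> \<B>" "x \<in> B'" "B' \<subseteq> U" "C' \<in> \<C>" "y \<in> C'" "C' \<subseteq> V"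
      using B(3) C(3) UV by meson
    then have "B' \<times> C' \<in> ?D" "z \<in> B' \<times> C'" "B' \<times> C' \<subseteq> W"
      using z UV(5) by auto
    then show "\<exists>V \<in> ?D. z \<in> V \<and> V \<subseteq> W" by blast
  qed
qed

lemma second_countable_euclidean:
  "second_countable (euclidean :: 'a::second_countable_topology topology)"
proof -
  obtain \<B> :: "'a set set" where B: "countable \<B>" "topological_basis \<B>"
    using ex_countable_basis by blast
  show ?thesis
    unfolding second_countable_def
    by (rule exI[of _ \<B>]) (metis B open_openin topological_basisE topological_basis_open)
qed

text \<open>This is the counting argument behind Urysohn metrization. Complete regularity separates
  a point from the complement of a basic set \<open>W\<close>, and the separating function is below
  1 on a basic neighbourhood \<open>V\<close> of the point. One function for each suitable pair
  \<open>(V, W)\<close> therefore suffices, and there are only countably many pairs.\<close>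

lemma second_countable_functions_determine_topology:
  assumes X: "second_countable X" "completely_regular_space X"
  shows "\<exists>k :: nat \<Rightarrow> 'a \<Rightarrow> real. (\<forall>n. continuous_map X euclideanreal (k n)) \<and>
    (\<forall>U x. openin X U \<longrightarrow> x \<in> U \<longrightarrow> (\<exists>n. k n x < 1 \<and> {z \<in> topspace X. k n z < 1} \<subseteq> U))"
proof -
  obtain \<B> where B: "countable \<B>" "\<And>V. V \<in> \<B> \<Longrightarrow> openin X V"
    "\<And>U x. openin X U \<Longrightarrow> x \<in> U \<Longrightarrow> \<exists>V \<in> \<B>. x \<in> V \<and> V \<subseteq> U"
    using X(1) unfolding second_countable_def by metis
  define P where "P V W f \<longleftrightarrow> continuous_map X euclideanreal f \<and> (\<forall>z \<in> V. f z < 1)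
    \<and> f ` (topspace X - W) \<subseteq> {1}" for V W and f :: "'a \<Rightarrow> real"
  define D where "D = {(V, W). V \<in> \<B> \<and> W \<in> \<B> \<and> (\<exists>f. P V W f)}"
  define q where "q = (\<lambda>(V, W). SOME f. P V W f)"
  have q: "P V W (q (V, W))" if "(V, W) \<in> D" for V W
    using that someI_ex[of "P V W"] unfolding D_def q_def by auto
  \<comment> \<open>The constant 1 keeps \<open>K\<close> nonempty, so that
    \<open>from_nat_into\<close> enumerates it even when \<open>D\<close> is empty. Its sublevel set
    at 1 is empty, so it does no harm.\<close>
  define K where "K = insert (\<lambda>_. 1) (q ` D)"
  have "D \<subseteq> \<B> \<times> \<B>" unfolding D_def by auto
  then have "countable K"
    unfolding K_def using B(1) countable_subset countable_SIGMA by (metis countable_image countable_insert)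
  then have range: "range (from_nat_into K) = K"
    unfolding K_def by (intro range_from_nat_into) auto
  have contK: "continuous_map X euclideanreal f" if "f \<in> K" for f
    using that q unfolding K_def P_def by auto
  show ?thesis
  proof (rule exI[of _ "from_nat_into K"], intro conjI allI impI)
    fix n show "continuous_map X euclideanreal (from_nat_into K n)"
      using contK range by blast
    fix U x assume U: "openin X U" "x \<in> U"
    obtain W where W: "W \<in> \<B>" "x \<in> W" "W \<subseteq> U" using B(3) U by meson
    obtain f where f: "continuous_map X euclideanreal f" "f x = 0" "f ` (topspace X - W) \<subseteq> {1}"
      using X(2) B(2) W unfolding completely_regular_space_alt' by metis
    have "openin X {z \<in> topspace X. f z \<in> {..<1}}"
      using f(1) by (rule openin_continuous_map_preimage) auto
    moreover have "x \<in> {z \<in> topspace X. f z \<in> {..<1}}"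
      using f(2) U openin_subset by auto
    ultimately obtain V where V: "V \<in> \<B>" "x \<in> V" "V \<subseteq> {z \<in> topspace X. f z \<in> {..<1}}"
      using B(3) by meson
    \<comment> \<open>The function selected for \<open>(V, W)\<close> may differ from
      \<open>f\<close>. The role of \<open>f\<close> is to show that the pair belongs to
      \<open>D\<close>; the selected function then satisfies \<open>P\<close> as well.\<close>
    then have "P V W f" using f unfolding P_def by auto
    then have VW: "(V, W) \<in> D" using V W unfolding D_def by auto
    then obtain n where n: "q (V, W) = from_nat_into K n"
      using range unfolding K_def by (metis image_eqI insertI2 rangeE)
    have "q (V, W) x < 1" "{z \<in> topspace X. q (V, W) z < 1} \<subseteq> U"
      using q[OF VW] V W unfolding P_def by fastforce+
    then have "q (V, W) x < 1 \<and> {z \<in> topspace X. q (V, W) z < 1} \<subseteq> U" by blast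
    then show "\<exists>n. from_nat_into K n x < 1 \<and> {z \<in> topspace X. from_nat_into K n z < 1} \<subseteq> U"
      unfolding n by (rule exI)
  qed
qed

section \<open>Initial topologies of sequences of real functions\<close>

text \<open>On sequences of reals \<open>euclidean\<close> is the product topology, so one pullback
  along the tuple map handles the whole family. The points stay those of \<open>A\<close>: points
  with equal tuples remain distinct but topologically indistinguishable, and the space need not be
  Hausdorff.\<close>

definition initial_topology :: "'a set \<Rightarrow> (nat \<Rightarrow> 'a \<Rightarrow> real) \<Rightarrow> 'a topology" where
  "initial_topology A \<phi> = pullback_topology A (\<lambda>x n. \<phi> n x) euclidean"

lemma topspace_initial_topology [simp]: "topspace (initial_topology A \<phi>) = A"
  by (simp add: initial_topology_def topspace_pullback_topology)

lemma continuous_map_into_functions: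
  "continuous_map X (euclidean :: (nat \<Rightarrow> real) topology) f \<longleftrightarrow>
    (\<forall>n. continuous_map X euclideanreal (\<lambda>x. f x n))"
  using continuous_map_componentwise_UNIV[of X "\<lambda>_. euclideanreal" f]
  by (simp add: euclidean_product_topology)

lemma continuous_map_initial_topology_tuple:
  "continuous_map (initial_topology A \<phi>) euclidean (\<lambda>x n. \<phi> n x)"
  using continuous_map_pullback[OF continuous_map_id, of A "\<lambda>x n. \<phi> n x" euclidean]
  by (simp add: initial_topology_def id_def comp_def)

lemma continuous_map_initial_topology_coordinate:
  "continuous_map (initial_topology A \<phi>) euclideanreal (\<phi> n)"
  using continuous_map_initial_topology_tuple[of A \<phi>]
  unfolding continuous_map_into_functions by simp

lemma continuous_map_into_initial_topology:
  assumes "\<And>x. x \<in> topspace X \<Longrightarrow> f x \<in> A"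
    and "\<And>n. continuous_map X euclideanreal (\<lambda>x. \<phi> n (f x))"
  shows "continuous_map X (initial_topology A \<phi>) f"
  unfolding initial_topology_def
  by (rule continuous_map_pullback') (use assms in \<open>auto simp: continuous_map_into_functions\<close>)

lemma continuous_map_initial_topology_mono:
  assumes "range \<psi> \<subseteq> range \<phi>"
  shows "continuous_map (initial_topology A \<phi>) (initial_topology A \<psi>) (\<lambda>x. x)"
proof (rule continuous_map_into_initial_topology)
  fix n
  obtain m where "\<psi> n = \<phi> m" using assms by blast
  then show "continuous_map (initial_topology A \<phi>) euclideanreal (\<lambda>x. \<psi> n x)"
    using continuous_map_initial_topology_coordinate by metis
qed simp

lemma continuous_map_prod_initial_topology_mono:
  assumes "range \<psi> \<subseteq> range \<phi>"
    and "continuous_map (prod_topology (initial_topology A \<psi>) (initial_topology A \<psi>)) Y F"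
  shows "continuous_map (prod_topology (initial_topology A \<phi>) (initial_topology A \<phi>)) Y F"
proof -
  have "continuous_map (prod_topology (initial_topology A \<phi>) (initial_topology A \<phi>))
      (prod_topology (initial_topology A \<psi>) (initial_topology A \<psi>)) (\<lambda>(x, y). (x, y))"
    using continuous_map_initial_topology_mono[OF assms(1), of A]
    by (simp only: continuous_map_prod_top) simp
  then show ?thesis
    using continuous_map_compose[OF _ assms(2)] by (fastforce simp: comp_def)
qed

text \<open>Open sets are preimages under the tuple map and cannot tell apart two points with the
  same tuple, whereas distinct images in a Hausdorff space could be told apart. This is what lets
  functions and group operations descend to the quotient by equality of tuples.\<close>

lemma continuous_map_initial_topology_eq:
  assumes F: "continuous_map (initial_topology A \<phi>) Y F" and Y: "Hausdorff_space Y"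
    and x: "x \<in> A" "x' \<in> A" "\<And>n. \<phi> n x = \<phi> n x'"
  shows "F x = F x'"
proof (rule ccontr)
  assume ne: "F x \<noteq> F x'"
  have "F x \<in> topspace Y" "F x' \<in> topspace Y"
    using F x continuous_map_image_subset_topspace by fastforce+
  then obtain U where U: "openin Y U" "F x \<in> U" "F x' \<notin> U"
    using Y ne unfolding Hausdorff_space_def disjnt_iff by metis
  have "openin (initial_topology A \<phi>) {z \<in> A. F z \<in> U}"
    using openin_continuous_map_preimage[OF F U(1)] by simp
  then obtain V where "{z \<in> A. F z \<in> U} = (\<lambda>x n. \<phi> n x) -` V \<inter> A"
    unfolding initial_topology_def openin_pullback_topology by blast
  then have V: "F z \<in> U \<longleftrightarrow> (\<lambda>n. \<phi> n z) \<in> V" if "z \<in> A" for z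
    using that by blast
  have "(\<lambda>n. \<phi> n x) = (\<lambda>n. \<phi> n x')"
    using x(3) by blast
  then show False using V[OF x(1)] V[OF x(2)] U by metis
qed

text \<open>The coordinates are exchanged one at a time, passing through
  \<open>(x', y)\<close>.\<close>

lemma continuous_map_prod_initial_topology_eq:
  assumes F: "continuous_map (prod_topology (initial_topology A \<phi>) (initial_topology A \<phi>)) Y F"
    and Y: "Hausdorff_space Y"
    and x: "x \<in> A" "x' \<in> A" "\<And>n. \<phi> n x = \<phi> n x'"
    and y: "y \<in> A" "y' \<in> A" "\<And>n. \<phi> n y = \<phi> n y'"
  shows "F (x, y) = F (x', y')"
proof -
  let ?T = "initial_topology A \<phi>"
  have "continuous_map ?T Y (F \<circ> (\<lambda>x. (x, y)))" "continuous_map ?T Y (F \<circ> (\<lambda>y. (x', y)))"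
    using x y by (auto intro!: continuous_map_compose[OF _ F] continuous_map_pairedI)
  from continuous_map_initial_topology_eq[OF this(1) Y x]
    continuous_map_initial_topology_eq[OF this(2) Y y]
  show ?thesis by simp
qed

section \<open>Countable families of functions adapted to a product\<close>

text \<open>Countably many real functions determine the topologies of the two second-countable
  factors. Pulled back to \<open>T\<close> along \<open>g1\<close> and \<open>g2\<close>, they form
  a countable family whose initial topology already makes \<open>g1\<close> and \<open>g2\<close>
  continuous, hence also \<open>F\<close>, which is \<open>h\<close> after their product.\<close>

lemma multiplicatively_R_factorizable_initial_topology:
  assumes T: "multiplicatively_R_factorizable T T"
    and F: "continuous_map (prod_topology T T) euclideanreal F"
  obtains \<psi> where "\<forall>n. continuous_map T euclideanreal (\<psi> n)"
    "continuous_map (prod_topology (initial_topology (topspace T) \<psi>) (initial_topology (topspace T) \<psi>))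
      euclideanreal F"
proof -
  obtain X Y :: "real topology" and g1 g2 h where
    X: "completely_regular_space X" "second_countable X" and
    Y: "completely_regular_space Y" "second_countable Y" and
    g: "continuous_map T X g1" "continuous_map T Y g2" and
    h: "continuous_map (prod_topology X Y) euclideanreal h" and
    eq: "\<And>x y. x \<in> topspace T \<Longrightarrow> y \<in> topspace T \<Longrightarrow> F (x, y) = h (g1 x, g2 y)"
    using T[unfolded multiplicatively_R_factorizable_def tychonoff_space_def, rule_format, OF F]
    by (elim exE conjE) (rule that; simp)
  obtain k :: "nat \<Rightarrow> real \<Rightarrow> real" where k: "\<forall>n. continuous_map X euclideanreal (k n)"
    "\<forall>U x. openin X U \<longrightarrow> x \<in> U \<longrightarrow> (\<exists>n. k n x < 1 \<and> {z \<in> topspace X. k n z < 1} \<subseteq> U)"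
    using second_countable_functions_determine_topology[OF X(2,1)] by (elim exE conjE) (rule that)
  obtain l :: "nat \<Rightarrow> real \<Rightarrow> real" where l: "\<forall>n. continuous_map Y euclideanreal (l n)"
    "\<forall>U x. openin Y U \<longrightarrow> x \<in> U \<longrightarrow> (\<exists>n. l n x < 1 \<and> {z \<in> topspace Y. l n z < 1} \<subseteq> U)"
    using second_countable_functions_determine_topology[OF Y(2,1)] by (elim exE conjE) (rule that)
  \<comment> \<open>Interleaving the two pulled-back families gives both copies of \<open>T\<close>
    the same coarser topology, as is needed when they are to become one group.\<close>
  define \<psi> where "\<psi> n = (if even n then k (n div 2) \<circ> g1 else l (n div 2) \<circ> g2)" for n
  have \<psi>: "continuous_map T euclideanreal (\<psi> n)" for n
    by (simp add: \<psi>_def continuous_map_compose[OF g(1) k(1)[rule_format]] continuous_map_compose[OF g(2) l(1)[rule_format]])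
  let ?I = "initial_topology (topspace T) \<psi>"
  \<comment> \<open>Stated for a general \<open>Z\<close> so that it covers \<open>g1\<close> and
    \<open>g2\<close> alike: around each point of the preimage of \<open>U\<close> lies the preimage
    of a sublevel set of some \<open>m n\<close>, which is open because \<open>m n \<circ> p\<close>
    belongs to the family.\<close>
  have cont: "continuous_map ?I Z p"
    if p: "continuous_map T Z p" and m: "\<forall>n. continuous_map Z euclideanreal (m n)"
      "\<forall>U x. openin Z U \<longrightarrow> x \<in> U \<longrightarrow> (\<exists>n. m n x < 1 \<and> {z \<in> topspace Z. m n z < 1} \<subseteq> U)"
      and mp: "\<And>n. m n \<circ> p \<in> range \<psi>" for Z :: "real topology" and p and m :: "nat \<Rightarrow> real \<Rightarrow> real"
  proof -
    have pZ: "p x \<in> topspace Z" if "x \<in> topspace T" for x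
      using continuous_map_image_subset_topspace[OF p] that by auto
    have "openin ?I {x \<in> topspace T. p x \<in> U}" if U: "openin Z U" for U
    proof (subst openin_subopen, intro ballI)
      fix x assume x: "x \<in> {x \<in> topspace T. p x \<in> U}"
      then obtain n where n: "m n (p x) < 1" "{z \<in> topspace Z. m n z < 1} \<subseteq> U"
        using m(2) U by blast
      obtain j where "m n \<circ> p = \<psi> j" using mp by blast
      then have "continuous_map ?I euclideanreal (m n \<circ> p)"
        using continuous_map_initial_topology_coordinate by metis
      then have "openin ?I {z \<in> topspace ?I. (m n \<circ> p) z \<in> {..<1}}"
        by (rule openin_continuous_map_preimage) auto
      then show "\<exists>V. openin ?I V \<and> x \<in> V \<and> V \<subseteq> {x \<in> topspace T. p x \<in> U}"
        using n x pZ by (intro exI[of _ "{z \<in> topspace ?I. (m n \<circ> p) z \<in> {..<1}}"]) auto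
    qed
    then show ?thesis
      using pZ by (auto simp: continuous_map_def)
  qed
  have kl: "k n \<circ> g1 \<in> range \<psi>" "l n \<circ> g2 \<in> range \<psi>" for n
    by (rule range_eqI[of _ _ "2 * n"], simp add: \<psi>_def)
      (rule range_eqI[of _ _ "2 * n + 1"], simp add: \<psi>_def)
  have "continuous_map ?I X g1" "continuous_map ?I Y g2"
    using cont[OF g(1) k kl(1)] cont[OF g(2) l kl(2)] .
  then have "continuous_map (prod_topology ?I ?I) euclideanreal (h \<circ> (\<lambda>(x, y). (g1 x, g2 y)))"
    by (intro continuous_map_compose[OF _ h]) (auto simp: continuous_map_prod_top)
  then have "continuous_map (prod_topology ?I ?I) euclideanreal F"
    by (rule continuous_map_eq) (auto simp: eq)
  with \<psi> that show thesis by blast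
qed

text \<open>Witness sequences are adjoined stage by stage, starting from \<open>\<psi>\<close>. The
  union of the countable stages \<open>S k\<close> is countable, and an element of one stage has its
  witness in the next. As \<open>P\<close> is arbitrary, a witness is only placed inside the range
  of \<open>\<phi>\<close>; passing from \<open>\<theta>\<close> to \<open>\<phi>\<close> is left to
  the application.\<close>

lemma sequence_closure:
  fixes \<psi> :: "nat \<Rightarrow> 'a"
  assumes \<psi>: "range \<psi> \<subseteq> C"
    and P: "\<forall>c \<in> C. \<exists>\<theta> :: nat \<Rightarrow> 'a. range \<theta> \<subseteq> C \<and> P c \<theta>"
  obtains \<phi> :: "nat \<Rightarrow> 'a" where "range \<psi> \<subseteq> range \<phi>" "range \<phi> \<subseteq> C"
    "\<forall>n. \<exists>\<theta>. range \<theta> \<subseteq> range \<phi> \<and> P (\<phi> n) \<theta>"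
proof -
  obtain N where N: "\<And>c. c \<in> C \<Longrightarrow> range (N c :: nat \<Rightarrow> 'a) \<subseteq> C \<and> P c (N c)"
    using P by metis
  define S where "S k = ((\<lambda>A. \<Union>c \<in> A. range (N c)) ^^ k) (range \<psi>)" for k
  have S0: "S 0 = range \<psi>" and SS: "S (Suc k) = (\<Union>c \<in> S k. range (N c))" for k
    unfolding S_def by auto
  have SC: "S k \<subseteq> C" for k
  proof (induction k)
    case (Suc k)
    then have "range (N c) \<subseteq> C" if "c \<in> S k" for c
      using N that by blast
    then show ?case unfolding SS by blast
  qed (simp add: S0 \<psi>)
  have "countable (S k)" for k
    by (induction k) (auto simp: S0 SS)
  then have "range (from_nat_into (\<Union>k. S k)) = (\<Union>k. S k)"
    using S0 by (intro range_from_nat_into) blast+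
  then obtain \<phi> :: "nat \<Rightarrow> 'a" where \<phi>: "range \<phi> = (\<Union>k. S k)" by (rule that)
  show thesis
  proof
    show "range \<psi> \<subseteq> range \<phi>"
      using S0 \<phi> by blast
    show "range \<phi> \<subseteq> C"
      using SC \<phi> by blast
    show "\<forall>n. \<exists>\<theta>. range \<theta> \<subseteq> range \<phi> \<and> P (\<phi> n) \<theta>"
    proof
      fix n
      have "\<phi> n \<in> (\<Union>k. S k)"
        unfolding \<phi>[symmetric] by (rule rangeI)
      then obtain k where k: "\<phi> n \<in> S k" by (rule UN_E)
      then have "range (N (\<phi> n)) \<subseteq> S (Suc k)"
        unfolding SS by (rule UN_upper)
      also have "\<dots> \<subseteq> range \<phi>"
        unfolding \<phi> by (rule UN_upper) simp
      finally show "\<exists>\<theta>. range \<theta> \<subseteq> range \<phi> \<and> P (\<phi> n) \<theta>"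
        using N k SC by blast
    qed
  qed
qed

section \<open>Topological groups\<close>

lemma topological_group_DirProd:
  assumes "topological_group G S" "topological_group H T"
  shows "topological_group (G \<times>\<times> H) (prod_topology S T)"
proof -
  interpret G: topological_group G S by fact
  interpret H: topological_group H T by fact
  let ?P = "prod_topology S T"
  have p: "continuous_map (prod_topology ?P ?P) S (\<lambda>z. fst (fst z))"
    "continuous_map (prod_topology ?P ?P) T (\<lambda>z. snd (fst z))"
    "continuous_map (prod_topology ?P ?P) S (\<lambda>z. fst (snd z))"
    "continuous_map (prod_topology ?P ?P) T (\<lambda>z. snd (snd z))"
    using continuous_map_compose[OF continuous_map_fst continuous_map_fst]
      continuous_map_compose[OF continuous_map_fst continuous_map_snd]
      continuous_map_compose[OF continuous_map_snd continuous_map_fst]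
      continuous_map_compose[OF continuous_map_snd continuous_map_snd]
    by (simp_all only: comp_def)
  have "continuous_map (prod_topology ?P ?P) S ((\<lambda>(x, y). x \<otimes>\<^bsub>G\<^esub> y) \<circ> (\<lambda>z. (fst (fst z), fst (snd z))))"
    "continuous_map (prod_topology ?P ?P) T ((\<lambda>(x, y). x \<otimes>\<^bsub>H\<^esub> y) \<circ> (\<lambda>z. (snd (fst z), snd (snd z))))"
    by (intro continuous_map_compose[OF _ G.continuous_mult] continuous_map_compose[OF _ H.continuous_mult]
        continuous_map_pairedI p)+
  then have "continuous_map (prod_topology ?P ?P) ?P (\<lambda>(x, y). x \<otimes>\<^bsub>G \<times>\<times> H\<^esub> y)"
    by (auto simp: continuous_map_pairwise comp_def case_prod_beta mult_DirProd')
  moreover have "continuous_map ?P ?P (\<lambda>(x, y). (inv\<^bsub>G\<^esub> x, inv\<^bsub>H\<^esub> y))"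
    using G.continuous_inv H.continuous_inv by (simp add: continuous_map_prod_top)
  then have "continuous_map ?P ?P (\<lambda>z. inv\<^bsub>G \<times>\<times> H\<^esub> z)"
    by (rule continuous_map_eq)
      (auto simp: G.topspace_eq_carrier H.topspace_eq_carrier inv_DirProd G.is_group H.is_group)
  moreover have "tychonoff_space ?P"
    using G.tychonoff H.tychonoff
    by (simp add: tychonoff_space_def completely_regular_space_prod_topology Hausdorff_space_prod_topology)
  ultimately show ?thesis
    unfolding topological_group_def topological_group_axioms_def
    using DirProd_group[OF G.is_group H.is_group]
    by (simp add: G.topspace_eq_carrier H.topspace_eq_carrier)
qed

text \<open>\<open>H\<close> is the image of \<open>G\<close> under the tuple map \<open>e\<close>,
  as a subspace of the metrizable, second-countable space of real sequences. The hypotheses say that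
  multiplication and inversion are continuous for the initial topology, so they respect the fibres
  of \<open>e\<close>. The section \<open>d\<close> serves to carry functions continuous for the
  initial topology over to \<open>H\<close>.\<close>

lemma (in topological_group) second_countable_quotient:
  assumes \<phi>: "\<And>n. continuous_map T euclideanreal (\<phi> n)"
    and mult: "\<And>n. continuous_map (prod_topology (initial_topology (carrier G) \<phi>)
      (initial_topology (carrier G) \<phi>)) euclideanreal (\<lambda>(x, y). \<phi> n (x \<otimes> y))"
    and inv: "\<And>n. continuous_map (initial_topology (carrier G) \<phi>) euclideanreal (\<lambda>x. \<phi> n (inv x))"
  obtains H :: "(nat \<Rightarrow> real) monoid" and S e d where
    "topological_group H S" "second_countable S" "e \<in> hom G H" "continuous_map T S e"
    "continuous_map S (initial_topology (carrier G) \<phi>) d"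
    "\<forall>x \<in> carrier G. \<forall>n. \<phi> n (d (e x)) = \<phi> n x"
proof -
  let ?I = "initial_topology (carrier G) \<phi>"
  define e where "e = (\<lambda>x n. \<phi> n x)"
  define S where "S = top_of_set (e ` carrier G)"
  define d where "d = inv_into (carrier G) e"
  have top: "topspace S = e ` carrier G" by (simp add: S_def)
  have d_in: "d a \<in> carrier G" and ed: "e (d a) = a" if "a \<in> topspace S" for a
    using that unfolding top d_def by (auto simp: inv_into_into f_inv_into_f)
  have e_in: "e x \<in> topspace S" if "x \<in> carrier G" for x
    using that by (simp add: top)
  have \<phi>d: "\<phi> n (d a) = a n" if "a \<in> topspace S" for a n
    using fun_cong[OF ed[OF that], of n] by (simp add: e_def)
  have de: "\<phi> n (d (e x)) = \<phi> n x" if "x \<in> carrier G" for x n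
    using \<phi>d[OF e_in[OF that]] by (simp add: e_def)
  have ceT: "continuous_map T S e"
    using \<phi> unfolding S_def
    by (auto simp: continuous_map_in_subtopology continuous_map_into_functions e_def topspace_eq_carrier)
  have ce: "continuous_map ?I S e"
    using continuous_map_initial_topology_tuple[of "carrier G" \<phi>]
    unfolding S_def by (auto simp: continuous_map_in_subtopology e_def)
  \<comment> \<open>The representatives are chosen arbitrarily, so continuity into \<open>T\<close>
    cannot be expected. The initial topology sees only the values \<open>\<phi> n (d a)\<close>, and
    these are the coordinates of \<open>a\<close>.\<close>
  have cd: "continuous_map S ?I d"
  proof (rule continuous_map_into_initial_topology)
    have "continuous_map S euclidean (\<lambda>a :: nat \<Rightarrow> real. a)"
      unfolding S_def by (simp add: continuous_map_from_subtopology)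
    then have "continuous_map S euclideanreal (\<lambda>a. a n)" for n
      by (simp add: continuous_map_into_functions)
    then show "continuous_map S euclideanreal (\<lambda>a. \<phi> n (d a))" for n
      by (rule continuous_map_eq) (simp add: \<phi>d)
  qed (rule d_in)
  have tych: "tychonoff_space S"
    unfolding S_def tychonoff_space_def
    by (simp add: Hausdorff_space_subtopology completely_regular_space_subtopology
        metrizable_imp_completely_regular_space metrizable_space_euclidean)
  have sc: "second_countable S"
    unfolding S_def by (simp add: second_countable_subtopology second_countable_euclidean)
  \<comment> \<open>These two facts make the operations of \<open>H\<close>, computed on
    representatives, independent of the choice made by \<open>d\<close>.\<close>
  have e_mult: "e (x' \<otimes> y') = e (x \<otimes> y)"
    if "x \<in> carrier G" "x' \<in> carrier G" "e x' = e x" "y \<in> carrier G" "y' \<in> carrier G" "e y' = e y"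
    for x x' y y'
    using continuous_map_prod_initial_topology_eq[OF mult, of x' x y' y] that
    by (auto simp: e_def fun_eq_iff)
  have e_inv: "e (inv x') = e (inv x)"
    if "x \<in> carrier G" "x' \<in> carrier G" "e x' = e x" for x x'
    using continuous_map_initial_topology_eq[OF inv, of x' x] that
    by (auto simp: e_def fun_eq_iff)
  define H where "H = \<lparr>carrier = topspace S, mult = (\<lambda>a b. e (d a \<otimes> d b)), one = e \<one>\<rparr>"
  have ede: "e (d (e x)) = e x" if "x \<in> carrier G" for x
    using ed e_in that by blast
  have H_mult: "e (d (e x) \<otimes> d (e y)) = e (x \<otimes> y)" if "x \<in> carrier G" "y \<in> carrier G" for x y
    using that by (intro e_mult) (auto simp: d_in e_in ede)
  have grp: "group H"
  proof (rule groupI)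
    fix a assume "a \<in> carrier H"
    then obtain x where x: "x \<in> carrier G" "a = e x" by (auto simp: H_def top)
    then show "\<exists>b \<in> carrier H. b \<otimes>\<^bsub>H\<^esub> a = \<one>\<^bsub>H\<^esub>"
      by (intro bexI[of _ "e (inv x)"]) (simp_all add: H_def e_in H_mult)
  qed (auto simp: H_def top H_mult m_assoc d_in e_in)
  have inv_eq: "inv\<^bsub>H\<^esub> a = e (inv (d a))" if "a \<in> topspace S" for a
  proof (rule group.inv_equality[OF grp])
    have "e (d (e (inv (d a))) \<otimes> d a) = e (inv (d a) \<otimes> d a)"
      using that by (intro e_mult) (auto simp: d_in e_in ede)
    then show "e (inv (d a)) \<otimes>\<^bsub>H\<^esub> a = \<one>\<^bsub>H\<^esub>"
      using that by (simp add: H_def d_in)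
  qed (use that in \<open>simp_all add: H_def e_in d_in\<close>)
  have "continuous_map (prod_topology ?I ?I) euclideanreal (\<lambda>z. \<phi> n (case z of (x, y) \<Rightarrow> x \<otimes> y))" for n
    using mult[of n] by (simp add: case_prod_unfold)
  then have mult_I: "continuous_map (prod_topology ?I ?I) ?I (\<lambda>(x, y). x \<otimes> y)"
    by (intro continuous_map_into_initial_topology) auto
  \<comment> \<open>Each operation of \<open>H\<close> is continuous as a composite: lift by
    \<open>d\<close> to the initial topology, operate in \<open>G\<close>, and return by
    \<open>e\<close>.\<close>
  have dd: "continuous_map (prod_topology S S) (prod_topology ?I ?I) (\<lambda>(a, b). (d a, d b))"
    using cd by (simp add: continuous_map_prod_top)
  have "continuous_map (prod_topology S S) S (e \<circ> ((\<lambda>(x, y). x \<otimes> y) \<circ> (\<lambda>(a, b). (d a, d b))))"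
    by (rule continuous_map_compose[OF continuous_map_compose[OF dd mult_I] ce])
  then have mult_H: "continuous_map (prod_topology S S) S (\<lambda>(a, b). a \<otimes>\<^bsub>H\<^esub> b)"
    by (rule continuous_map_eq) (auto simp: H_def)
  have "continuous_map ?I ?I (\<lambda>x. inv x)"
    by (rule continuous_map_into_initial_topology) (simp, rule inv)
  then have "continuous_map S S (e \<circ> ((\<lambda>x. inv x) \<circ> d))"
    by (rule continuous_map_compose[OF continuous_map_compose[OF cd] ce])
  then have inv_H: "continuous_map S S (\<lambda>a. inv\<^bsub>H\<^esub> a)"
    by (rule continuous_map_eq) (simp add: inv_eq)
  have "carrier H = topspace S"
    by (simp add: H_def)
  then have "topological_group H S"
    using grp tych mult_H inv_H by (simp add: topological_group_def topological_group_axioms_def)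
  moreover have "e \<in> hom G H"
    by (auto simp: hom_def H_def e_in H_mult)
  ultimately show thesis
    using that sc ceT cd de by blast
qed

section \<open>The two implications\<close>

lemma R_factorizable_group_imp_multiplicatively:
  assumes G: "topological_group G T"
    and R: "R_factorizable_group (G \<times>\<times> G) (prod_topology T T)"
  shows "multiplicatively_R_factorizable T T"
  unfolding multiplicatively_R_factorizable_def
proof (intro allI impI)
  fix f assume f: "continuous_map (prod_topology T T) euclideanreal f"
  interpret G: topological_group G T by fact
  obtain H :: "real monoid" and S h g where
    H: "topological_group H S" and S: "second_countable S" and
    h: "h \<in> hom (G \<times>\<times> G) H" "continuous_map (prod_topology T T) S h" and
    g: "continuous_map S euclideanreal g" and
    eq: "\<forall>x \<in> topspace (prod_topology T T). f x = g (h x)"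
    using R f unfolding R_factorizable_group_def by blast
  interpret H: topological_group H S by fact
  \<comment> \<open>The restrictions of \<open>h\<close> to the two axes multiply in
    \<open>H\<close> to \<open>h\<close>. Both factor spaces are therefore \<open>S\<close>, and the
    outer function is \<open>g\<close> after the multiplication of \<open>H\<close>.\<close>
  let ?h1 = "h \<circ> (\<lambda>x. (x, \<one>\<^bsub>G\<^esub>))" and ?h2 = "h \<circ> (\<lambda>y. (\<one>\<^bsub>G\<^esub>, y))"
  have "continuous_map T S ?h1" "continuous_map T S ?h2"
    by (auto intro!: continuous_map_compose[OF _ h(2)] continuous_map_pairedI
        simp: G.topspace_eq_carrier)
  moreover have "continuous_map (prod_topology S S) euclideanreal (g \<circ> (\<lambda>(x, y). x \<otimes>\<^bsub>H\<^esub> y))"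
    using H.continuous_mult g by (rule continuous_map_compose)
  moreover have "f (x, y) = (g \<circ> (\<lambda>(x, y). x \<otimes>\<^bsub>H\<^esub> y)) (?h1 x, ?h2 y)"
    if "x \<in> topspace T" "y \<in> topspace T" for x y
    using that eq hom_mult[OF h(1), of "(x, \<one>\<^bsub>G\<^esub>)" "(\<one>\<^bsub>G\<^esub>, y)"]
    by (simp add: G.topspace_eq_carrier)
  ultimately show "\<exists>(X' :: real topology) (Y' :: real topology) g1 g2 h.
        tychonoff_space X' \<and> second_countable X' \<and>
        tychonoff_space Y' \<and> second_countable Y' \<and>
        continuous_map T X' g1 \<and> continuous_map T Y' g2 \<and>
        continuous_map (prod_topology X' Y') euclideanreal h \<and>
        (\<forall>x \<in> topspace T. \<forall>y \<in> topspace T. f (x, y) = h (g1 x, g2 y))"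
    using S H.tychonoff by blast
qed

text \<open>A single countable family on \<open>G\<close> controls both arguments of
  \<open>f\<close>, so it is enough to coarsen the topology of \<open>G\<close> itself; the
  homomorphism on the product is then \<open>e\<close> applied in each coordinate.\<close>

lemma multiplicatively_imp_R_factorizable_group:
  assumes G: "topological_group G T"
    and R: "multiplicatively_R_factorizable T T"
  shows "R_factorizable_group (G \<times>\<times> G) (prod_topology T T)"
  unfolding R_factorizable_group_def
proof (intro allI impI)
  fix f assume f: "continuous_map (prod_topology T T) euclideanreal f"
  interpret G: topological_group G T by fact
  define C where "C = {c. continuous_map T euclideanreal c}"
  define I where "I \<theta> = initial_topology (carrier G) \<theta>" for \<theta>
  \<comment> \<open>The two clauses are what \<open>c\<close> requires of the family for
    multiplication and inversion to become continuous. Both survive enlarging the range of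
    \<open>\<theta>\<close>.\<close>
  define P where "P c \<theta> \<longleftrightarrow>
    continuous_map (prod_topology (I \<theta>) (I \<theta>)) euclideanreal (\<lambda>(x, y). c (x \<otimes>\<^bsub>G\<^esub> y)) \<and>
    (\<lambda>x. c (inv\<^bsub>G\<^esub> x)) \<in> range \<theta>" for c and \<theta> :: "nat \<Rightarrow> 'a \<Rightarrow> real"
  have factor: "\<exists>\<theta>. range \<theta> \<subseteq> C \<and> continuous_map (prod_topology (I \<theta>) (I \<theta>)) euclideanreal F"
    if F: "continuous_map (prod_topology T T) euclideanreal F" for F
  proof -
    obtain \<theta> where "\<forall>n. continuous_map T euclideanreal (\<theta> n)"
      "continuous_map (prod_topology (initial_topology (topspace T) \<theta>)
        (initial_topology (topspace T) \<theta>)) euclideanreal F"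
      by (rule multiplicatively_R_factorizable_initial_topology[OF R F]) (rule that)
    then show ?thesis
      by (intro exI[of _ \<theta>]) (auto simp: C_def I_def G.topspace_eq_carrier)
  qed
  obtain \<psi> where \<psi>: "range \<psi> \<subseteq> C" "continuous_map (prod_topology (I \<psi>) (I \<psi>)) euclideanreal f"
    using factor[OF f] by (elim exE conjE) (rule that)
  \<comment> \<open>A larger family has a finer initial topology, so joint continuity obtained for
    one witness passes to the closed-off family.\<close>
  have mono: "continuous_map (prod_topology (I \<theta>') (I \<theta>')) euclideanreal F"
    if "range \<theta> \<subseteq> range \<theta>'" "continuous_map (prod_topology (I \<theta>) (I \<theta>)) euclideanreal F"
    for \<theta> \<theta>' F
    using continuous_map_prod_initial_topology_mono that unfolding I_def .
  have P: "\<forall>c \<in> C. \<exists>\<theta>. range \<theta> \<subseteq> C \<and> P c \<theta>"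
  proof
    fix c assume "c \<in> C"
    then have c: "continuous_map T euclideanreal c" by (simp add: C_def)
    have "continuous_map (prod_topology T T) euclideanreal (\<lambda>(x, y). c (x \<otimes>\<^bsub>G\<^esub> y))"
      using continuous_map_compose[OF G.continuous_mult c] by (simp add: comp_def case_prod_unfold)
    from factor[OF this] obtain \<theta> where \<theta>: "range \<theta> \<subseteq> C"
      "continuous_map (prod_topology (I \<theta>) (I \<theta>)) euclideanreal (\<lambda>(x, y). c (x \<otimes>\<^bsub>G\<^esub> y))"
      by (elim exE conjE) (rule that)
    \<comment> \<open>The function for inversion is put at index 0 and \<open>\<theta>\<close> is
      shifted by one.\<close>
    let ?\<theta> = "case_nat (\<lambda>x. c (inv\<^bsub>G\<^esub> x)) \<theta>"
    have range: "range ?\<theta> = insert (\<lambda>x. c (inv\<^bsub>G\<^esub> x)) (range \<theta>)"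
    proof (intro equalityI subsetI)
      fix u assume "u \<in> range ?\<theta>"
      then obtain n where "u = ?\<theta> n" by (rule rangeE)
      then show "u \<in> insert (\<lambda>x. c (inv\<^bsub>G\<^esub> x)) (range \<theta>)"
        by (cases n) (simp_all only: nat.case insertI1 insertI2 rangeI)
    next
      fix u assume "u \<in> insert (\<lambda>x. c (inv\<^bsub>G\<^esub> x)) (range \<theta>)"
      then consider "u = ?\<theta> 0" | n where "u = ?\<theta> (Suc n)" by auto
      then show "u \<in> range ?\<theta>" by cases (simp_all only: rangeI)
    qed
    have "(\<lambda>x. c (inv\<^bsub>G\<^esub> x)) \<in> C"
      using continuous_map_compose[OF G.continuous_inv c] by (simp add: C_def comp_def)
    then have "range ?\<theta> \<subseteq> C"
      using \<theta>(1) by (simp add: range)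
    moreover have "P c ?\<theta>"
      using mono[of \<theta> ?\<theta>, OF _ \<theta>(2)] unfolding P_def range by blast
    ultimately show "\<exists>\<theta>. range \<theta> \<subseteq> C \<and> P c \<theta>" by blast
  qed
  obtain \<phi> :: "nat \<Rightarrow> 'a \<Rightarrow> real" where \<phi>: "range \<psi> \<subseteq> range \<phi>" "range \<phi> \<subseteq> C"
    "\<forall>n. \<exists>\<theta>. range \<theta> \<subseteq> range \<phi> \<and> P (\<phi> n) \<theta>"
    by (rule sequence_closure[of \<psi> C P, OF \<psi>(1) P]) (rule that)
  have f\<phi>: "continuous_map (prod_topology (I \<phi>) (I \<phi>)) euclideanreal f"
    by (rule mono[OF \<phi>(1) \<psi>(2)])
  have mult: "continuous_map (prod_topology (I \<phi>) (I \<phi>)) euclideanreal (\<lambda>(x, y). \<phi> n (x \<otimes>\<^bsub>G\<^esub> y))" for n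
  proof -
    obtain \<theta> where "range \<theta> \<subseteq> range \<phi>"
      "continuous_map (prod_topology (I \<theta>) (I \<theta>)) euclideanreal (\<lambda>(x, y). \<phi> n (x \<otimes>\<^bsub>G\<^esub> y))"
      using \<phi>(3)[rule_format, of n] unfolding P_def by blast
    then show ?thesis by (rule mono)
  qed
  have inv: "continuous_map (I \<phi>) euclideanreal (\<lambda>x. \<phi> n (inv\<^bsub>G\<^esub> x))" for n
  proof -
    obtain m where "(\<lambda>x. \<phi> n (inv\<^bsub>G\<^esub> x)) = \<phi> m"
      using \<phi>(3)[rule_format, of n] unfolding P_def by blast
    then show ?thesis
      unfolding I_def by (simp add: continuous_map_initial_topology_coordinate)
  qed
  have cont: "continuous_map T euclideanreal (\<phi> n)" for n
    using \<phi>(2) unfolding C_def by blast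
  obtain H :: "(nat \<Rightarrow> real) monoid" and S e d where
    H: "topological_group H S" and S: "second_countable S" and
    e: "e \<in> hom G H" "continuous_map T S e" and
    d: "continuous_map S (initial_topology (carrier G) \<phi>) d" and
    de: "\<forall>x \<in> carrier G. \<forall>n. \<phi> n (d (e x)) = \<phi> n x"
    by (rule G.second_countable_quotient[OF cont mult[unfolded I_def] inv[unfolded I_def]]) (rule that)
  have e_in: "e x \<in> topspace S" if "x \<in> carrier G" for x
    using continuous_map_image_subset_topspace[OF e(2)] that by (auto simp: G.topspace_eq_carrier)
  have d_in: "d a \<in> carrier G" if "a \<in> topspace S" for a
    using continuous_map_image_subset_topspace[OF d] that by auto
  \<comment> \<open>The group found consists of pairs of real sequences, so it still has to be
    transported to the type \<open>real\<close>.\<close>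
  show "\<exists>(H :: real monoid) S h g.
        topological_group H S \<and> second_countable S \<and>
        h \<in> hom (G \<times>\<times> G) H \<and> continuous_map (prod_topology T T) S h \<and>
        continuous_map S euclideanreal g \<and>
        (\<forall>x \<in> topspace (prod_topology T T). f x = g (h x))"
  proof (rule group_factorization_over_real)
    show "topological_group (H \<times>\<times> H) (prod_topology S S)"
      using H H by (rule topological_group_DirProd)
    show "second_countable (prod_topology S S)"
      using S S by (rule second_countable_prod_topology)
    show "(\<lambda>(x, y). (e x, e y)) \<in> hom (G \<times>\<times> G) (H \<times>\<times> H)"
      using e(1) by (auto simp: hom_def Pi_iff)
    show "continuous_map (prod_topology T T) (prod_topology S S) (\<lambda>(x, y). (e x, e y))"
      using e(2) by (simp add: continuous_map_prod_top)
    show "continuous_map (prod_topology S S) euclideanreal (f \<circ> (\<lambda>(a, b). (d a, d b)))"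
      using d by (intro continuous_map_compose[OF _ f\<phi>]) (simp add: continuous_map_prod_top I_def)
    \<comment> \<open>A point and its representative have the same values under every
      \<open>\<phi> n\<close>, and \<open>f\<close>, being continuous for the product of the initial
      topologies, cannot distinguish them.\<close>
    have "f (d (e x), d (e y)) = f (x, y)" if "x \<in> carrier G" "y \<in> carrier G" for x y
      using continuous_map_prod_initial_topology_eq[OF f\<phi>[unfolded I_def] Hausdorff_space_euclidean,
        of "d (e x)" x "d (e y)" y] that de d_in e_in by blast
    then show "\<forall>z \<in> topspace (prod_topology T T).
        f z = (f \<circ> (\<lambda>(a, b). (d a, d b))) ((\<lambda>(x, y). (e x, e y)) z)"
      unfolding topspace_prod_topology G.topspace_eq_carrier comp_def by force
  qed
qed

theorem theorem4:
  fixes G :: "('a, 'm) monoid_scheme" and T :: "'a topology"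
  assumes "topological_group G T"
  shows "R_factorizable_group (G \<times>\<times> G) (prod_topology T T) \<longleftrightarrow>
    multiplicatively_R_factorizable T T"
  using R_factorizable_group_imp_multiplicatively[OF assms]
    multiplicatively_imp_R_factorizable_group[OF assms] by (rule iffI)

end
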